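(* Let $C$ be the correlation matrix of a Gaussian Fermionic state of $n$ modes, let $dC$ be an infinitesimal variation of $C$ within the correlation matrices of Gaussian Fermionic states, and let $ds^2$ be the corresponding rescaled Bures metric $$ds^2=\operatorname{Tr}\left[dC\,(\mathbb 1-\mathrm{Ad}_C)^{-1}dC\right].$$ Then $$ds^2\le 2n\,P_C\,\|dC\|_\infty^2,\qquad P_C=\left\|(\mathbb 1+C^{\otimes 2})^{-1}\right\|_\infty ,$$ where $(\cdot)^{-1}$ denotes the pseudo-inverse.
   Context: The correlation matrix of a Gaussian Fermionic state $\rho$ of $n$ modes is the $2n\times 2n$ imaginary antisymmetric (hence Hermitian) matrix $C_{ij}=\frac12\operatorname{Tr}(\rho[w_i,w_j])$, where $w_1,\dots,w_{2n}$ are Hermitian Majorana operators with $\{w_i,w_j\}=2\delta_{ij}$; a Gaussian Fermionic state is a density operator of the form $\rho=\prod_{k=1}^n\frac{1-i c_k z_{2k-1}z_{2k}}{2}$ with $z_i=\sum_jQ_{ij}w_j$, $Q$ real orthogonal, $|c_k|\le1$. $\mathrm{Ad}_C X:=CXC^\dagger=CXC$ acts on $2n\times2n$ complex matrices. $C^{\otimes2}=C\otimes C$ acts on $\mathbb C^{2n}\otimes\mathbb C^{2n}$. $\|A\|_\infty$ is the largest singular value of $A$. If $C$ depends on parameters $\lambda_\mu$, then $dC=\sum_\mu d\lambda_\mu\,\partial_\mu C$. The quantity $ds^2$ is the expression, in terms of $C$, of $8\,ds_B^2=16[1-\mathcal F(\rho,\rho+d\rho)]$, with $ds_B^2$ the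 Bures metric and $\mathcal F(\rho,\sigma)=\operatorname{Tr}\sqrt{\sqrt\rho\,\sigma\sqrt\rho}$ the Uhlmann fidelity. *)

theory Defs
  imports "HOL-Analysis.Analysis"
begin

section \<open>Complex matrices\<close>

definition dagger :: "complex^'a^'b \<Rightarrow> complex^'b^'a" where
  "dagger A = (\<chi> i j. cnj (A $ j $ i))"

definition kron :: "complex^'a^'b \<Rightarrow> complex^'c^'d \<Rightarrow> complex^('a \<times> 'c)^('b \<times> 'd)" where
  "kron A B = (\<chi> p q. A $ fst p $ fst q * B $ snd p $ snd q)"

definition singular_values :: "complex^'a^'a \<Rightarrow> real set" where
  "singular_values A =
     {s. 0 \<le> s \<and> (\<exists>v. v \<noteq> 0 \<and> (dagger A ** A) *v v = complex_of_real (s\<^sup>2) *s v)}"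

definition norm_inf :: "complex^'a^'a \<Rightarrow> real" where
  "norm_inf A = Max (singular_values A)"

text \<open>Moore--Penrose pseudo-inverses are given by the four Penrose conditions, for matrices and
  for maps on the space of matrices (with the Hilbert--Schmidt inner product).\<close>

definition pinv :: "complex^'a^'a \<Rightarrow> complex^'a^'a" where
  "pinv A = (THE B. A ** B ** A = A \<and> B ** A ** B = B \<and>
                    dagger (A ** B) = A ** B \<and> dagger (B ** A) = B ** A)"

definition hs_inner :: "complex^'a^'a \<Rightarrow> complex^'a^'a \<Rightarrow> complex" where
  "hs_inner X Y = trace (dagger X ** Y)"

definition pinv_super ::
    "(complex^'a^'a \<Rightarrow> complex^'a^'a) \<Rightarrow> (complex^'a^'a \<Rightarrow> complex^'a^'a)" where
  "pinv_super T = (THE S. (\<forall>X. T (S (T X)) = T X) \<and> (\<forall>X. S (T (S X)) = S X) \<and>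
                    (\<forall>X Y. hs_inner (T (S X)) Y = hs_inner X (T (S Y))) \<and>
                    (\<forall>X Y. hs_inner (S (T X)) Y = hs_inner X (S (T Y))))"

section \<open>Gaussian Fermionic states\<close>

text \<open>The number of modes is \<open>CARD('n)\<close>. The Majorana operators \<open>w\<^sub>1, \<dots>, w\<^sub>2\<^sub>n\<close> are indexed by
  \<open>'n \<times> bool\<close>: \<open>(k, False)\<close> stands for \<open>2k - 1\<close> and \<open>(k, True)\<close> for \<open>2k\<close>. Operators are matrices
  on a Hilbert space with orthonormal basis indexed by \<open>'h\<close>.\<close>

definition majorana :: "('n::finite \<times> bool \<Rightarrow> complex^'h^'h) \<Rightarrow> bool" where
  "majorana w \<longleftrightarrow> CARD('h) = 2 ^ CARD('n) \<and> (\<forall>i. dagger (w i) = w i) \<and>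
     (\<forall>i j. w i ** w j + w j ** w i = (if i = j then mat 2 else 0))"

definition density_operator :: "complex^'h^'h \<Rightarrow> bool" where
  "density_operator \<rho> \<longleftrightarrow> dagger \<rho> = \<rho> \<and>
     (\<forall>v. 0 \<le> Re (\<Sum>i\<in>UNIV. cnj (v $ i) * (\<rho> *v v) $ i)) \<and> trace \<rho> = 1"

text \<open>Here \<open>mat x ** A\<close> is the scalar multiple \<open>x A\<close>.\<close>

definition gaussian_state ::
    "('n::{finite,linorder} \<times> bool \<Rightarrow> complex^'h^'h) \<Rightarrow> complex^'h^'h \<Rightarrow> bool" where
  "gaussian_state w \<rho> \<longleftrightarrow> density_operator \<rho> \<and>
     (\<exists>(Q :: real^('n \<times> bool)^('n \<times> bool)) (c :: 'n \<Rightarrow> real).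
        orthogonal_matrix Q \<and> (\<forall>k. \<bar>c k\<bar> \<le> 1) \<and>
        (let z = (\<lambda>i. \<Sum>j\<in>UNIV. Q $ i $ j *\<^sub>R w j);
             factor = (\<lambda>k. (1/2) *\<^sub>R
               (mat 1 - mat (\<i> * complex_of_real (c k)) ** z (k, False) ** z (k, True)))
         in \<rho> = foldr (**) (map factor (sorted_list_of_set UNIV)) (mat 1)))"

definition correlation_matrix ::
    "('n::finite \<times> bool \<Rightarrow> complex^'h^'h) \<Rightarrow> complex^'h^'h \<Rightarrow> complex^('n \<times> bool)^('n \<times> bool)" where
  "correlation_matrix w \<rho> = (\<chi> i j. trace (\<rho> ** (w i ** w j - w j ** w i)) / 2)"

definition gaussian_correlations ::
    "('n::{finite,linorder} \<times> bool \<Rightarrow> complex^'h^'h) \<Rightarrow> (complex^('n \<times> bool)^('n \<times> bool)) set" where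
  "gaussian_correlations w = {correlation_matrix w \<rho> | \<rho>. gaussian_state w \<rho>}"

text \<open>An infinitesimal variation of \<open>C\<close> within a set \<open>\<G>\<close> of matrices is the velocity of a curve in
  \<open>\<G>\<close> that starts at \<open>C\<close>. Only times \<open>t \<ge> 0\<close> are required, so that variations of boundary points
  (such as pure states) into the interior are included.\<close>

definition infinitesimal_variation ::
    "(complex^'a^'a) set \<Rightarrow> complex^'a^'a \<Rightarrow> complex^'a^'a \<Rightarrow> bool" where
  "infinitesimal_variation \<G> C dC \<longleftrightarrow>
     (\<exists>\<gamma> \<epsilon>. 0 < \<epsilon> \<and> \<gamma> 0 = C \<and> (\<forall>t\<in>{0..<\<epsilon>}. \<gamma> t \<in> \<G>) \<and>
            (\<gamma> has_vector_derivative dC) (at 0 within {0..<\<epsilon>::real}))"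

text \<open>In particular the variations \<open>dC = \<Sum>\<^sub>\<mu> d\<lambda>\<^sub>\<mu> \<partial>\<^sub>\<mu>C\<close> of a family with several parameters are of
  this form.\<close>

lemma infinitesimal_variation_parameters:
  fixes C :: "real^'m \<Rightarrow> complex^'a^'a"
  assumes "open \<Lambda>" "l \<in> \<Lambda>" "\<And>l'. l' \<in> \<Lambda> \<Longrightarrow> C l' \<in> \<G>" "C differentiable (at l)"
  shows "infinitesimal_variation \<G> (C l)
           (\<Sum>\<mu>\<in>UNIV. dl $ \<mu> *\<^sub>R vector_derivative (\<lambda>t. C (l + t *\<^sub>R axis \<mu> 1)) (at 0))"
proof -
  obtain D where D: "(C has_derivative D) (at l)"
    using assms(4) by (auto simp: differentiable_def)
  then interpret D: bounded_linear D by (rule has_derivative_bounded_linear)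
  have line: "((\<lambda>t. C (l + t *\<^sub>R v)) has_vector_derivative D v) (at 0)" for v
  proof -
    have "((\<lambda>t::real. l + t *\<^sub>R v) has_derivative (\<lambda>t. t *\<^sub>R v)) (at 0)"
      by (auto intro!: derivative_eq_intros)
    moreover have "(C has_derivative D) (at (l + (0::real) *\<^sub>R v))"
      using D by simp
    ultimately show ?thesis
      unfolding has_vector_derivative_def
      by (auto dest: has_derivative_compose simp: D.scaleR)
  qed
  have "D dl = D (\<Sum>\<mu>\<in>UNIV. dl $ \<mu> *\<^sub>R axis \<mu> 1)"
    using basis_expansion[of dl] by (simp add: scalar_mult_eq_scaleR)
  also have "\<dots> = (\<Sum>\<mu>\<in>UNIV. dl $ \<mu> *\<^sub>R vector_derivative (\<lambda>t. C (l + t *\<^sub>R axis \<mu> 1)) (at 0))"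
    by (simp add: D.sum D.scaleR vector_derivative_at[OF line])
  finally have D_eq: "D dl = \<dots>" .
  have "((\<lambda>t::real. l + t *\<^sub>R dl) \<longlongrightarrow> l + 0 *\<^sub>R dl) (at_right 0)"
    by (intro tendsto_intros)
  then have "eventually (\<lambda>t::real. l + t *\<^sub>R dl \<in> \<Lambda>) (at_right 0)"
    using assms(1,2) by (auto dest: topological_tendstoD)
  then obtain \<epsilon> :: real where \<epsilon>: "0 < \<epsilon>" "\<And>t. 0 < t \<Longrightarrow> t < \<epsilon> \<Longrightarrow> l + t *\<^sub>R dl \<in> \<Lambda>"
    by (auto simp: eventually_at_right[of 0 1])
  then have "C (l + t *\<^sub>R dl) \<in> \<G>" if "t \<in> {0..<\<epsilon>}" for t
    using that assms(2,3) by (cases "t = 0") simp_all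
  then show ?thesis
    using \<epsilon>(1) unfolding infinitesimal_variation_def D_eq[symmetric]
    by (intro exI[of _ "\<lambda>t. C (l + t *\<^sub>R dl)"] exI[of _ \<epsilon>])
       (simp add: has_vector_derivative_at_within[OF line])
qed

section \<open>The rescaled Bures metric\<close>

definition Ad :: "complex^'a^'a \<Rightarrow> complex^'a^'a \<Rightarrow> complex^'a^'a" where
  "Ad C X = C ** X ** dagger C"

definition bures_ds2 :: "complex^'a^'a \<Rightarrow> complex^'a^'a \<Rightarrow> complex" where
  "bures_ds2 C dC = trace (dC ** pinv_super (\<lambda>X. X - Ad C X) dC)"

definition P_factor :: "complex^'a^'a \<Rightarrow> real" where
  "P_factor C = norm_inf (pinv (mat 1 + kron C C))"

end

theory Submission
  imports Defs
begin

text \<open>Since \<open>C\<close> is antisymmetric, flattening matrices to vectors turns the map \<open>X \<mapsto> X - C X C\<close>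
  into multiplication by \<open>1 + C \<otimes> C\<close>. Hence \<open>ds\<^sup>2 = \<langle>dC, (1 + C \<otimes> C)\<^sup>-\<^sup>1 dC\<rangle>\<close> in the Hilbert--Schmidt
  inner product, which is at most \<open>P\<^sub>C\<close> times the squared Hilbert--Schmidt norm of \<open>dC\<close>, and the latter
  is at most \<open>2n\<close> times the squared operator norm.\<close>

section \<open>The adjoint of a matrix\<close>

text \<open>The real-valued \<open>\<bullet>\<close> on complex vectors is the real part of this
  product. Norms and orthogonality only involve \<open>\<bullet>\<close>; the full complex value
  serves to show that ds^2 is real.\<close>

definition cdot :: "complex^'a \<Rightarrow> complex^'a \<Rightarrow> complex" where
  "cdot u v = (\<Sum>i\<in>UNIV. cnj (u $ i) * v $ i)"

lemma dagger_dagger [simp]: "dagger (dagger A) = A"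
  by (simp add: dagger_def vec_eq_iff)

lemma dagger_mat_1 [simp]: "dagger (mat 1) = mat 1"
  by (simp add: dagger_def mat_def vec_eq_iff)

lemma dagger_add: "dagger (A + B) = dagger A + dagger B"
  by (simp add: dagger_def vec_eq_iff)

lemma dagger_matrix_mult: "dagger (A ** B) = dagger B ** dagger A"
  by (simp add: dagger_def matrix_matrix_mult_def vec_eq_iff mult.commute)

lemma cnj_trace: "cnj (trace A) = trace (dagger A)"
  by (simp add: trace_def dagger_def)

lemma bounded_linear_dagger: "bounded_linear (dagger :: complex^'a^'b \<Rightarrow> _)"
  unfolding linear_conv_bounded_linear[symmetric]
  by (rule linearI) (simp_all add: dagger_def vec_eq_iff)

lemma cdot_dagger: "cdot (A *v u) v = cdot u (dagger A *v v)"
proof -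
  have "cdot (A *v u) v = (\<Sum>i\<in>UNIV. \<Sum>j\<in>UNIV. cnj (A $ i $ j) * cnj (u $ j) * v $ i)"
    by (simp add: cdot_def matrix_vector_mult_def sum_distrib_right)
  also have "\<dots> = (\<Sum>j\<in>UNIV. \<Sum>i\<in>UNIV. cnj (A $ i $ j) * cnj (u $ j) * v $ i)"
    by (rule sum.swap)
  also have "\<dots> = cdot u (dagger A *v v)"
    by (simp add: cdot_def matrix_vector_mult_def dagger_def sum_distrib_left mult_ac)
  finally show ?thesis .
qed

lemma cnj_cdot: "cnj (cdot u v) = cdot v u"
  by (simp add: cdot_def mult.commute)

lemma Re_cdot: "Re (cdot u v) = u \<bullet> v"
  by (simp add: cdot_def inner_vec_def inner_complex_def)

lemma inner_dagger: "(A *v u) \<bullet> v = u \<bullet> (dagger A *v v)"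
  using cdot_dagger[of A u v] by (metis Re_cdot)

lemma of_real_scalar_mult: "complex_of_real r *s v = r *\<^sub>R v"
  by (simp add: vec_eq_iff) (simp add: scaleR_conv_of_real)

lemma linear_matrix_vector_mult: "linear ((*v) (A :: complex^'a^'b))"
  by (rule linearI)
     (simp_all add: matrix_vector_right_distrib vector_scalar_commute flip: of_real_scalar_mult)

lemma matrix_vector_mult_axis: "A *v axis j 1 = column j A" for A :: "complex^'a^'b"
  by (simp add: vec_eq_iff matrix_vector_mult_def axis_def column_def if_distrib cong: if_cong)

section \<open>The largest singular value\<close>

text \<open>Distinct singular values are nonnegative, so their squares are distinct eigenvalues of
  the Hermitian matrix \<open>dagger A ** A\<close>. Their eigenvectors are orthogonal, hence
  independent, hence finitely many. This gives the \<open>Max\<close> in \<open>norm_inf\<close> its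
  meaning.\<close>

lemma finite_singular_values: "finite (singular_values A)"
proof -
  define H where "H = dagger A ** A"
  have H: "dagger H = H"
    by (simp add: H_def dagger_matrix_mult)
  define ev where "ev s = (SOME v. v \<noteq> 0 \<and> H *v v = s\<^sup>2 *\<^sub>R v)" for s :: real
  have ev: "ev s \<noteq> 0" "H *v ev s = s\<^sup>2 *\<^sub>R ev s" if "s \<in> singular_values A" for s
    using someI_ex[of "\<lambda>v. v \<noteq> 0 \<and> H *v v = s\<^sup>2 *\<^sub>R v"] that
    unfolding singular_values_def ev_def H_def of_real_scalar_mult by auto
  have orth: "ev s \<bullet> ev t = 0"
    if "s \<in> singular_values A" "t \<in> singular_values A" "s \<noteq> t" for s t
  proof -
    have "s\<^sup>2 * (ev s \<bullet> ev t) = t\<^sup>2 * (ev s \<bullet> ev t)"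
      using inner_dagger[of H "ev s" "ev t"] ev that by (simp add: H)
    moreover have "s\<^sup>2 \<noteq> t\<^sup>2"
      using that by (auto simp: singular_values_def power2_eq_iff_nonneg)
    ultimately show ?thesis by simp
  qed
  have inj: "inj_on ev (singular_values A)"
    by (rule inj_onI) (metis ev(1) inner_eq_zero_iff orth)
  have "pairwise orthogonal (ev ` singular_values A)"
    by (auto simp: pairwise_def orthogonal_def intro: orth)
  moreover have "0 \<notin> ev ` singular_values A"
    using ev(1) by fastforce
  ultimately have "finite (ev ` singular_values A)"
    by (intro independent_imp_finite pairwise_orthogonal_independent)
  then show ?thesis
    using inj by (rule finite_imageD)
qed

text \<open>A zero of a nonnegative quadratic form is a minimum. If \<open>N *v v\<close> were
  nonzero, moving from \<open>v\<close> against it would make the form negative, since the term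
  linear in \<open>t\<close> dominates for small \<open>t\<close>.\<close>

lemma psd_kernel:
  fixes N :: "complex^'a^'a"
  assumes "dagger N = N" "\<And>x. 0 \<le> x \<bullet> (N *v x)" "v \<bullet> (N *v v) = 0"
  shows "N *v v = 0"
proof (rule ccontr)
  interpret linear "(*v) N" by (rule linear_matrix_vector_mult)
  assume "N *v v \<noteq> 0"
  define y where "y = N *v v"
  define a b where "a = y \<bullet> y" and "b = y \<bullet> (N *v y)"
  have a: "0 < a" using \<open>N *v v \<noteq> 0\<close> by (simp add: a_def y_def)
  have *: "0 \<le> t\<^sup>2 * b - 2 * t * a" for t
  proof -
    have "v \<bullet> (N *v y) = a"
      using inner_dagger[of N v y] assms(1) by (simp add: y_def a_def)
    then have "(v - t *\<^sub>R y) \<bullet> (N *v (v - t *\<^sub>R y)) = t\<^sup>2 * b - 2 * t * a"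
      using assms(3)
      by (simp add: diff scale inner_diff_left inner_diff_right a_def b_def power2_eq_square
          right_diff_distrib inner_commute[of v y] flip: y_def)
    then show ?thesis using assms(2)[of "v - t *\<^sub>R y"] by simp
  qed
  \<comment> \<open>Taking \<open>t = 1\<close> makes the division by \<open>b\<close> legitimate.
    The minimiser \<open>t = a / b\<close> of the quadratic then gives the value
    \<open>- a\<^sup>2 / b\<close>, which is negative.\<close>
  have "0 < b" using *[of 1] a by simp
  then show False
    using *[of "a / b"] a by (simp add: power2_eq_square field_simps mult_le_0_iff)
qed

text \<open>Let \<open>s\<close> be the maximum of \<open>norm (A *v x)\<close> on the unit sphere,
  attained at \<open>v\<close>. Then \<open>N\<close>, that is
  \<open>s\<^sup>2 - dagger A ** A\<close>, is positive semidefinite and its form vanishes at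
  \<open>v\<close>. By \<open>psd_kernel\<close>, \<open>v\<close> is an eigenvector, so
  \<open>s\<close> is itself a singular value.\<close>

lemma norm_matrix_vector_mult_le:
  fixes A :: "complex^'a^'a"
  shows "0 \<le> norm_inf A" "norm (A *v x) \<le> norm_inf A * norm x"
proof -
  interpret A: linear "(*v) A" by (rule linear_matrix_vector_mult)
  have "continuous_on (sphere 0 1) (\<lambda>x. norm (A *v x))"
    by (intro continuous_on_norm linear_continuous_on)
       (simp add: linear_matrix_vector_mult flip: linear_conv_bounded_linear)
  moreover have "sphere (0 :: complex^'a) 1 \<noteq> {}"
    using vector_choose_size[of 1] by fastforce
  ultimately obtain v :: "complex^'a" where v: "norm v = 1"
    and max: "\<And>u. norm u = 1 \<Longrightarrow> norm (A *v u) \<le> norm (A *v v)"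
    using continuous_attains_sup[of "sphere 0 1" "\<lambda>x. norm (A *v x)"] by auto
  define s where "s = norm (A *v v)"
  have bound: "norm (A *v x) \<le> s * norm x" for x
  proof (cases "x = 0")
    case True
    then show ?thesis by simp
  next
    case False
    then have "norm (A *v ((1 / norm x) *\<^sub>R x)) \<le> s"
      unfolding s_def by (intro max) simp
    then show ?thesis
      using False by (simp add: A.scale field_simps)
  qed
  define N where "N = mat (complex_of_real (s\<^sup>2)) - dagger A ** A"
  have N: "N *v x = s\<^sup>2 *\<^sub>R x - dagger A *v (A *v x)" for x
  proof -
    have "mat (complex_of_real (s\<^sup>2)) *v x = s\<^sup>2 *\<^sub>R x"
      by (simp add: vec_eq_iff matrix_vector_mult_def mat_def if_distrib if_distribR
          cong: if_cong flip: of_real_scalar_mult)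
    then show ?thesis
      by (simp add: N_def matrix_vector_mult_diff_rdistrib matrix_vector_mul_assoc)
  qed
  have quadratic: "x \<bullet> (N *v x) = (s * norm x)\<^sup>2 - (norm (A *v x))\<^sup>2" for x
    using inner_dagger[of A x "A *v x"]
    by (simp add: N inner_diff_right power_mult_distrib power2_norm_eq_inner)
  have "N *v v = 0"
  proof (rule psd_kernel)
    show "dagger N = N"
      by (auto simp: N_def vec_eq_iff dagger_def mat_def matrix_matrix_mult_def mult.commute)
    show "0 \<le> x \<bullet> (N *v x)" for x
      unfolding quadratic using power_mono[OF bound[of x], of 2] by simp
    show "v \<bullet> (N *v v) = 0"
      unfolding quadratic by (simp add: v s_def)
  qed
  then have "s \<in> singular_values A"
    using v N[of v] unfolding singular_values_def of_real_scalar_mult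
    by (auto simp: s_def matrix_vector_mul_assoc intro!: exI[of _ v])
  then have le: "s \<le> norm_inf A"
    unfolding norm_inf_def by (rule Max_ge[OF finite_singular_values])
  then show "0 \<le> norm_inf A"
    by (rule order_trans[rotated]) (simp add: s_def)
  show "norm (A *v x) \<le> norm_inf A * norm x"
    using bound[of x] mult_right_mono[OF le norm_ge_zero[of x]] by linarith
qed

section \<open>Pseudo-inverses\<close>

definition penrose :: "complex^'a^'a \<Rightarrow> complex^'a^'a \<Rightarrow> bool" where
  "penrose A B \<longleftrightarrow> A ** B ** A = A \<and> B ** A ** B = B \<and>
     dagger (A ** B) = A ** B \<and> dagger (B ** A) = B ** A"

text \<open>Both \<open>A ** B\<close> and \<open>A ** B'\<close> are Hermitian projections onto the
  range of \<open>A\<close>, so they coincide; likewise \<open>B ** A\<close> and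
  \<open>B' ** A\<close>. Then \<open>B = B ** A ** B = B' ** A ** B' = B'\<close>.\<close>

lemma penrose_unique:
  assumes "penrose A B" "penrose A B'"
  shows "B = B'"
proof -
  note penrose = assms[unfolded penrose_def]
  have "A ** B' ** (A ** B) = A ** B" "B ** A ** (B' ** A) = B ** A"
    using penrose by (simp_all only: matrix_mul_assoc) (simp only: matrix_mul_assoc[symmetric])
  then have "dagger (A ** B' ** (A ** B)) = dagger (A ** B)"
      "dagger (B ** A ** (B' ** A)) = dagger (B ** A)"
    by simp_all
  then have eqs: "A ** B ** (A ** B') = A ** B" "B' ** A ** (B ** A) = B ** A"
    by (simp_all only: dagger_matrix_mult[of "A ** B'"] dagger_matrix_mult[of "B ** A"] penrose)
  have 1: "A ** B' = A ** B"
    using eqs(1) penrose by (simp add: matrix_mul_assoc)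
  have "B' ** A ** (B ** A) = B' ** (A ** B ** A)"
    by (simp only: matrix_mul_assoc)
  then have 2: "B ** A = B' ** A"
    using eqs(2) penrose by simp
  have "B = B ** A ** B"
    using penrose by simp
  also have "\<dots> = B' ** (A ** B)"
    by (simp add: 2 matrix_mul_assoc)
  also have "\<dots> = B'"
    using penrose by (simp add: matrix_mul_assoc flip: 1)
  finally show ?thesis .
qed

text \<open>The kernel of a Hermitian matrix is the orthogonal complement of its range. Splitting
  \<open>x\<close> along this decomposition shows that \<open>M *v x\<close> is already the image of
  a vector in the range.\<close>

lemma hermitian_factor_square:
  fixes M :: "complex^'a^'a"
  assumes "dagger M = M"
  obtains Z where "M = M ** M ** Z"
proof -
  interpret linear "(*v) M" by (rule linear_matrix_vector_mult)
  have "\<exists>w. M *v (M *v w) = M *v x" for x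
  proof -
    have sub: "subspace (range ((*v) M))"
      using linear_matrix_vector_mult subspace_UNIV by (rule linear_subspace_image)
    obtain y z where y: "y \<in> span (range ((*v) M))"
      and z: "\<And>w. w \<in> span (range ((*v) M)) \<Longrightarrow> orthogonal z w" and x: "x = y + z"
      by (metis orthogonal_subspace_decomp_exists)
    have "(M *v z) \<bullet> (M *v z) = z \<bullet> (M *v (M *v z))"
      using inner_dagger[of M z "M *v z"] assms by simp
    also have "\<dots> = 0"
      using z[of "M *v (M *v z)"] by (simp add: orthogonal_def span_base)
    finally have "M *v z = 0" by simp
    moreover obtain w where "y = M *v w"
      using y sub by (auto simp: span_eq_iff[THEN iffD2])
    ultimately have "M *v (M *v w) = M *v x"
      by (simp add: x add)
    then show ?thesis ..
  qed
  then obtain W where W: "\<And>x. M *v (M *v W x) = M *v x"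
    by metis
  \<comment> \<open>The choice function \<open>W\<close> need not be linear; only its values on the
    basis vectors are used, as the columns of \<open>Z\<close>.\<close>
  define Z where "Z = (\<chi> i j. W (axis j 1) $ i)"
  have Z: "Z *v axis j 1 = W (axis j 1)" for j
    by (simp add: Z_def vec_eq_iff matrix_vector_mult_axis column_def)
  have "column j (M ** M ** Z) = column j M" for j
    using W[of "axis j 1"]
    by (simp add: Z flip: matrix_vector_mult_axis matrix_vector_mul_assoc)
  then have "M = M ** M ** Z"
    by (simp add: vec_eq_iff column_def)
  then show ?thesis ..
qed

text \<open>The pseudo-inverse is written down as the group inverse: it is \<open>Z\<^sup>\<dagger> M Z\<close> if \<open>M = M\<^sup>2 Z\<close>.\<close>

lemma hermitian_penrose:
  fixes M :: "complex^'a^'a"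
  assumes "dagger M = M"
  shows "\<exists>B. penrose M B \<and> dagger B = B"
proof -
  obtain Z where Z: "M = M ** M ** Z"
    using hermitian_factor_square[OF assms] by metis
  have Z': "M = dagger Z ** M ** M"
    using arg_cong[OF Z, of dagger] by (simp add: dagger_matrix_mult assms matrix_mul_assoc)
  \<comment> \<open>Both sides equal \<open>dagger Z ** M ** M ** Z\<close>. Hence
    \<open>M ** Z\<close> is Hermitian; it becomes the common value of \<open>M ** B\<close> and
    \<open>B ** M\<close>.\<close>
  have "dagger Z ** M = dagger Z ** (M ** M ** Z)"
    using Z by (rule arg_cong)
  then have comm: "dagger Z ** M = M ** Z"
    by (simp add: matrix_mul_assoc flip: Z')
  define B where "B = dagger Z ** M ** Z"
  have MB: "M ** B = M ** Z"
    by (simp add: B_def comm matrix_mul_assoc flip: Z)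
  have "B ** M = dagger Z ** (dagger Z ** M ** M)"
    by (simp only: B_def comm[symmetric] matrix_mul_assoc[symmetric])
  also have "\<dots> = dagger Z ** M"
    by (simp only: Z'[symmetric])
  finally have BM: "B ** M = M ** Z"
    by (simp only: comm)
  have "M ** B ** M = M"
    by (simp only: MB comm[symmetric] Z'[symmetric])
  moreover have "B ** M ** B = B"
  proof -
    have "B ** M ** B = dagger Z ** (M ** B)"
      by (simp only: BM comm[symmetric] matrix_mul_assoc)
    also have "\<dots> = B"
      by (simp only: MB) (simp only: B_def matrix_mul_assoc)
    finally show ?thesis .
  qed
  moreover have "dagger (M ** Z) = M ** Z"
    by (simp add: dagger_matrix_mult assms comm)
  moreover have "dagger B = B"
    by (simp add: B_def dagger_matrix_mult assms matrix_mul_assoc)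
  ultimately show ?thesis
    by (intro exI[of _ B]) (simp add: penrose_def MB BM)
qed

lemma
  assumes "dagger M = M"
  shows penrose_pinv: "penrose M (pinv M)"
    and dagger_pinv: "dagger (pinv M) = pinv M"
proof -
  obtain B where B: "penrose M B" "dagger B = B"
    using hermitian_penrose[OF assms] by blast
  have "pinv M = B"
    unfolding pinv_def using B(1) penrose_unique
    by (intro the_equality) (auto simp: penrose_def)
  then show "penrose M (pinv M)" "dagger (pinv M) = pinv M"
    using B by simp_all
qed

section \<open>Superoperators as matrices\<close>

text \<open>Row-major vectorisation, with the index order of \<open>kron\<close>: left
  multiplication by \<open>A\<close> and right multiplication by the transpose of \<open>B\<close>
  together become \<open>kron A B\<close>.\<close>

definition flat :: "complex^'a^'a \<Rightarrow> complex^('a \<times> 'a)" where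
  "flat X = (\<chi> p. X $ fst p $ snd p)"

definition unflat :: "complex^('a \<times> 'a) \<Rightarrow> complex^'a^'a" where
  "unflat v = (\<chi> i j. v $ (i, j))"

lemma flat_unflat [simp]: "flat (unflat v) = v"
  by (simp add: flat_def unflat_def vec_eq_iff)

lemma flat_inject: "flat X = flat Y \<longleftrightarrow> X = Y"
  by (simp add: flat_def vec_eq_iff)

lemma hs_inner_flat: "hs_inner X Y = cdot (flat X) (flat Y)"
proof -
  have "hs_inner X Y = (\<Sum>j\<in>UNIV. \<Sum>i\<in>UNIV. cnj (X $ i $ j) * Y $ i $ j)"
    by (simp add: hs_inner_def trace_def matrix_matrix_mult_def dagger_def)
  also have "\<dots> = (\<Sum>i\<in>UNIV. \<Sum>j\<in>UNIV. cnj (X $ i $ j) * Y $ i $ j)"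
    by (rule sum.swap)
  also have "\<dots> = cdot (flat X) (flat Y)"
    by (simp add: cdot_def flat_def sum.cartesian_product UNIV_Times_UNIV case_prod_unfold)
  finally show ?thesis .
qed

lemma hs_inner_eqI:
  assumes "\<And>Y. hs_inner X Y = hs_inner X' Y"
  shows "X = X'"
proof -
  have "flat X \<bullet> v = flat X' \<bullet> v" for v
    using assms[of "unflat v"] by (metis Re_cdot flat_unflat hs_inner_flat)
  then show ?thesis
    by (metis flat_inject vector_eq_rdot)
qed

definition penrose_super ::
    "(complex^'a^'a \<Rightarrow> complex^'a^'a) \<Rightarrow> (complex^'a^'a \<Rightarrow> complex^'a^'a) \<Rightarrow> bool" where
  "penrose_super T S \<longleftrightarrow> (\<forall>X. T (S (T X)) = T X) \<and> (\<forall>X. S (T (S X)) = S X) \<and>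
     (\<forall>X Y. hs_inner (T (S X)) Y = hs_inner X (T (S Y))) \<and>
     (\<forall>X Y. hs_inner (S (T X)) Y = hs_inner X (S (T Y)))"

text \<open>The argument of \<open>penrose_unique\<close>, with self-adjointness expressed through
  \<open>hs_inner\<close>. The description in \<open>pinv_super\<close> ranges over arbitrary maps,
  so matrix uniqueness cannot simply be transported.\<close>

lemma penrose_super_unique:
  assumes "penrose_super T S" "penrose_super T S'"
  shows "S = S'"
proof
  fix X
  have S: "T (S (T X)) = T X" "S (T (S X)) = S X"
      "hs_inner (T (S X)) Y = hs_inner X (T (S Y))"
      "hs_inner (S (T X)) Y = hs_inner X (S (T Y))" for X Y
    using assms(1) unfolding penrose_super_def by blast+
  have S': "T (S' (T X)) = T X" "S' (T (S' X)) = S' X"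
      "hs_inner (T (S' X)) Y = hs_inner X (T (S' Y))"
      "hs_inner (S' (T X)) Y = hs_inner X (S' (T Y))" for X Y
    using assms(2) unfolding penrose_super_def by blast+
  have 1: "T (S X) = T (S' X)" for X
  proof (rule hs_inner_eqI)
    fix Y
    \<comment> \<open>Both projections move across the inner product in turn; each side then
      collapses by the first Penrose condition.\<close>
    have "hs_inner (T (S' (T (S X)))) Y = hs_inner X (T (S (T (S' Y))))"
      by (simp only: S(3) S'(3))
    then show "hs_inner (T (S X)) Y = hs_inner (T (S' X)) Y"
      by (simp only: S(1) S'(1) S'(3))
  qed
  have 2: "S (T X) = S' (T X)" for X
  proof (rule hs_inner_eqI)
    fix Y
    have "hs_inner (S (T (S' (T X)))) Y = hs_inner X (S' (T (S (T Y))))"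
      by (simp only: S(4) S'(4))
    then show "hs_inner (S (T X)) Y = hs_inner (S' (T X)) Y"
      by (simp only: S(1) S'(1) S'(4))
  qed
  have "S X = S (T (S X))"
    by (simp only: S(2))
  also have "\<dots> = S' (T (S' X))"
    by (simp only: 1 2)
  also have "\<dots> = S' X"
    by (simp only: S'(2))
  finally show "S X = S' X" .
qed

text \<open>Flattening preserves the inner products, so \<open>pinv M\<close> carried back to
  matrices satisfies the Penrose conditions for \<open>T\<close>; uniqueness identifies it with
  \<open>pinv_super T\<close>.\<close>

lemma flat_pinv_super:
  fixes T :: "complex^'a^'a \<Rightarrow> complex^'a^'a"
  assumes "dagger M = M" and T: "\<And>X. flat (T X) = M *v flat X"
  shows "flat (pinv_super T X) = pinv M *v flat X"
proof -
  define S where "S X = unflat (pinv M *v flat X)" for X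
  have S: "flat (S X) = pinv M *v flat X" for X
    by (simp add: S_def)
  have "penrose_super T S"
    unfolding penrose_super_def flat_inject[symmetric]
    using penrose_pinv[OF assms(1)]
    by (simp add: penrose_def T S hs_inner_flat matrix_vector_mul_assoc matrix_mul_assoc
        cdot_dagger)
  then have "pinv_super T = S"
    unfolding pinv_super_def using penrose_super_unique
    by (intro the_equality) (auto simp: penrose_super_def)
  then show ?thesis
    by (simp add: S)
qed

text \<open>Hermiticity gives \<open>Ad C X = C ** X ** C\<close>, and antisymmetry turns the right
  factor into minus its transpose. This sign is why a plus stands before
  \<open>kron C C\<close>.\<close>

lemma flat_diff_Ad:
  fixes C :: "complex^'a^'a"
  assumes "transpose C = - C" "dagger C = C"
  shows "flat (X - Ad C X) = (mat 1 + kron C C) *v flat X"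
proof -
  have skew: "C $ l $ j = - C $ j $ l" for j l
    using arg_cong[OF assms(1), of "\<lambda>A. A $ j $ l"] by (simp add: transpose_def)
  have "Ad C X $ i $ j = - (kron C C *v flat X) $ (i, j)" for i j
  proof -
    have "Ad C X $ i $ j = (\<Sum>l\<in>UNIV. \<Sum>k\<in>UNIV. C $ i $ k * X $ k $ l * C $ l $ j)"
      by (simp add: Ad_def assms(2) matrix_matrix_mult_def sum_distrib_right)
    also have "\<dots> = (\<Sum>k\<in>UNIV. \<Sum>l\<in>UNIV. C $ i $ k * X $ k $ l * C $ l $ j)"
      by (rule sum.swap)
    also have "\<dots> = - (\<Sum>k\<in>UNIV. \<Sum>l\<in>UNIV. C $ i $ k * C $ j $ l * X $ k $ l)"
      by (simp add: skew[of _ j] sum_negf mult_ac)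
    also have "\<dots> = - (kron C C *v flat X) $ (i, j)"
      by (simp add: matrix_vector_mult_def kron_def flat_def sum.cartesian_product
          UNIV_Times_UNIV case_prod_unfold)
    finally show ?thesis .
  qed
  then show ?thesis
    by (simp add: vec_eq_iff matrix_vector_mult_add_rdistrib)
       (simp add: flat_def)
qed

section \<open>The estimate for Hermitian antisymmetric matrices\<close>

lemma dagger_kron: "dagger (kron A B) = kron (dagger A) (dagger B)"
  by (simp add: dagger_def kron_def vec_eq_iff)

text \<open>The squared Hilbert-Schmidt norm is the sum of the squared norms of the columns, and
  each column is the image of a unit vector.\<close>

lemma norm_flat_le:
  fixes X :: "complex^'a^'a"
  shows "(norm (flat X))\<^sup>2 \<le> real CARD('a) * (norm_inf X)\<^sup>2"
proof -
  have "(norm (flat X))\<^sup>2 = (\<Sum>i\<in>UNIV. \<Sum>j\<in>UNIV. (norm (X $ i $ j))\<^sup>2)"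
    by (simp add: norm_vec_def L2_set_def sum_nonneg flat_def sum.cartesian_product
        UNIV_Times_UNIV case_prod_unfold)
  also have "\<dots> = (\<Sum>j\<in>UNIV. \<Sum>i\<in>UNIV. (norm (X $ i $ j))\<^sup>2)"
    by (rule sum.swap)
  also have "\<dots> = (\<Sum>j\<in>UNIV. (norm (X *v axis j 1))\<^sup>2)"
    by (simp add: matrix_vector_mult_axis column_def norm_vec_def L2_set_def sum_nonneg)
  also have "\<dots> \<le> (\<Sum>j\<in>(UNIV :: 'a set). (norm_inf X)\<^sup>2)"
  proof (rule sum_mono)
    fix j :: 'a
    have "norm (X *v axis j 1) \<le> norm_inf X"
      using norm_matrix_vector_mult_le(2)[of X "axis j 1"] by (simp add: norm_eq_1 inner_axis_axis)
    then show "(norm (X *v axis j 1))\<^sup>2 \<le> (norm_inf X)\<^sup>2"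
      by (rule power_mono) simp
  qed
  finally show ?thesis by simp
qed

lemma bures_ds2_le:
  fixes C dC :: "complex^'a^'a"
  assumes C: "transpose C = - C" "dagger C = C" and dC: "dagger dC = dC"
  shows "bures_ds2 C dC \<in> \<real>"
    and "Re (bures_ds2 C dC) \<le> real CARD('a) * P_factor C * (norm_inf dC)\<^sup>2"
proof -
  define M where "M = mat 1 + kron C C"
  have M: "dagger M = M"
    by (simp add: M_def dagger_add dagger_kron C)
  have flat_T: "flat (X - Ad C X) = M *v flat X" for X
    unfolding M_def using C by (rule flat_diff_Ad)
  \<comment> \<open>Since \<open>dC\<close> is Hermitian, the trace is a Hilbert-Schmidt inner
    product.\<close>
  have "bures_ds2 C dC = hs_inner dC (pinv_super (\<lambda>X. X - Ad C X) dC)"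
    by (simp add: bures_ds2_def hs_inner_def dC)
  then have ds2: "bures_ds2 C dC = cdot (flat dC) (pinv M *v flat dC)"
    by (simp add: hs_inner_flat flat_pinv_super[OF M flat_T])
  have "cnj (bures_ds2 C dC) = bures_ds2 C dC"
    by (simp add: ds2 cnj_cdot cdot_dagger dagger_pinv[OF M])
  then show "bures_ds2 C dC \<in> \<real>"
    by (simp add: Reals_cnj_iff)
  have "Re (bures_ds2 C dC) \<le> norm (flat dC) * norm (pinv M *v flat dC)"
    unfolding ds2 Re_cdot by (rule norm_cauchy_schwarz)
  also have "\<dots> \<le> norm (flat dC) * (P_factor C * norm (flat dC))"
    unfolding P_factor_def M_def
    by (intro mult_left_mono norm_matrix_vector_mult_le) simp
  also have "\<dots> = P_factor C * (norm (flat dC))\<^sup>2"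
    by (simp add: power2_eq_square)
  also have "\<dots> \<le> P_factor C * (real CARD('a) * (norm_inf dC)\<^sup>2)"
    unfolding P_factor_def
    by (intro mult_left_mono norm_flat_le norm_matrix_vector_mult_le)
  finally show "Re (bures_ds2 C dC) \<le> real CARD('a) * P_factor C * (norm_inf dC)\<^sup>2"
    by (simp add: mult_ac)
qed

section \<open>Correlation matrices\<close>

lemma transpose_correlation_matrix:
  "transpose (correlation_matrix w \<rho>) = - correlation_matrix w \<rho>"
proof -
  have "trace (\<rho> ** (A - B)) = trace (\<rho> ** A) - trace (\<rho> ** B)" for A B
    by (simp add: trace_def matrix_matrix_mult_def right_diff_distrib sum_subtractf)
  then show ?thesis
    by (simp add: transpose_def correlation_matrix_def vec_eq_iff diff_divide_distrib)
qed

text \<open>Taking adjoints reverses products, which undoes the swap of indices in the commutator;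
  cyclicity of the trace puts \<open>\<rho>\<close> back in front.\<close>

lemma dagger_correlation_matrix:
  assumes "\<And>i. dagger (w i) = w i" "dagger \<rho> = \<rho>"
  shows "dagger (correlation_matrix w \<rho>) = correlation_matrix w \<rho>"
proof -
  interpret d: bounded_linear dagger by (rule bounded_linear_dagger)
  have "dagger (\<rho> ** (w j ** w i - w i ** w j)) = (w i ** w j - w j ** w i) ** \<rho>" for i j
    by (simp add: dagger_matrix_mult assms d.diff)
  then have "cnj (trace (\<rho> ** (w j ** w i - w i ** w j))) =
      trace (\<rho> ** (w i ** w j - w j ** w i))" for i j
    unfolding cnj_trace by (metis trace_mul_sym)
  then show ?thesis
    by (simp add: dagger_def correlation_matrix_def vec_eq_iff)
qed

text \<open>The map \<open>dagger\<close> is real linear and fixes every point of the curve, so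
  \<open>dagger dC\<close> is also its velocity at 0.\<close>

lemma dagger_infinitesimal_variation:
  assumes "infinitesimal_variation \<G> C dC" and \<G>: "\<And>A. A \<in> \<G> \<Longrightarrow> dagger A = A"
  shows "dagger dC = dC"
proof -
  obtain \<gamma> \<epsilon> where \<epsilon>: "0 < \<epsilon>" and \<gamma>: "\<And>t. t \<in> {0..<\<epsilon>} \<Longrightarrow> \<gamma> t \<in> \<G>"
    and deriv: "(\<gamma> has_vector_derivative dC) (at 0 within {0..<\<epsilon>::real})"
    using assms(1) unfolding infinitesimal_variation_def by blast
  have "((\<lambda>t. dagger (\<gamma> t)) has_vector_derivative dagger dC) (at 0 within {0..<\<epsilon>})"
    using bounded_linear_dagger deriv by (rule bounded_linear.has_vector_derivative)
  then have "(\<gamma> has_vector_derivative dagger dC) (at 0 within {0..<\<epsilon>})"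
    by (rule has_vector_derivative_transform[rotated 2]) (use \<epsilon> \<gamma> \<G> in auto)
  \<comment> \<open>The one-sided filter is nontrivial, so the derivative is unique.\<close>
  moreover have "at 0 within {0..<\<epsilon>} = at_right 0"
    using \<epsilon> by (intro at_within_nhd[of 0 "{-\<epsilon><..<\<epsilon>}"]) auto
  ultimately show ?thesis
    using deriv vector_derivative_unique_within[of 0 "{0..<\<epsilon>}"] by simp
qed

theorem mainTheorem2:
  fixes w :: "'n::{finite,linorder} \<times> bool \<Rightarrow> complex^'h^'h"
    and \<rho> :: "complex^'h^'h"
    and C dC :: "complex^('n \<times> bool)^('n \<times> bool)"
  assumes "majorana w"
    and "gaussian_state w \<rho>"
    and "C = correlation_matrix w \<rho>"
    and "infinitesimal_variation (gaussian_correlations w) C dC"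
  shows "bures_ds2 C dC \<in> \<real> \<and>
    Re (bures_ds2 C dC) \<le> 2 * real CARD('n) * P_factor C * (norm_inf dC)\<^sup>2"
proof -
  \<comment> \<open>All Gaussian states are covered because the curve defining \<open>dC\<close>
    passes through other correlation matrices than \<open>C\<close>.\<close>
  have herm: "dagger (correlation_matrix w \<sigma>) = correlation_matrix w \<sigma>"
    if "gaussian_state w \<sigma>" for \<sigma>
    using assms(1) that
    by (intro dagger_correlation_matrix)
       (auto simp: majorana_def gaussian_state_def density_operator_def)
  have "dagger dC = dC"
    using assms(4) by (rule dagger_infinitesimal_variation) (auto simp: gaussian_correlations_def herm)
  moreover have "transpose C = - C" "dagger C = C"
    using assms(2) by (simp_all add: assms(3) transpose_correlation_matrix herm)
  \<comment> \<open>The index type \<open>'n \<times> bool\<close> has \<open>2 * CARD('n)\<close>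
    elements, whence the factor 2n.\<close>
  ultimately show ?thesis
    using bures_ds2_le[of C dC] by (simp add: mult_ac)
qed

end
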